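(* Let $R>2$ be a fixed real number. Then there does not exist a sequence $(a_n)_{n\ge1}$ of positive real numbers with $a_n\to\infty$ and $a_n=O(n)$ as $n\to\infty$ that determines the rate of the moment convergence for all even moments $r=2k<R$ ($k$ a positive integer) and for all models in $\mathcal{LM}(R)$. That is, there is no such sequence $(a_n)$ with the property that, for every model in $\mathcal{LM}(R)$, every admissible normalization $\mathbf{\Gamma}_n$ of it with associated matrix $\mathbf{V}$, every $\boldsymbol{\alpha}\in\mathbb{R}^p$, and every even positive integer $r<R$, $$\mathbb{E}(\xi_n^r)-\mathbb{E}(\xi^r)=O(a_n^{-1})\quad\text{as } n\to\infty,$$ where $\xi_n=\boldsymbol{\alpha}^T\mathbf{\Gamma}_n(\boldsymbol{b}_n-\boldsymbol{\beta})$ and $\xi\sim N(0,\sigma^2\boldsymbol{\alpha}^T\mathbf{V}\boldsymbol{\alpha})$.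
   Context: Linear regression model. Fix an integer $p\ge1$, a parameter $\boldsymbol{\beta}\in\mathbb{R}^p$, a sequence of nonrandom vectors $\boldsymbol{x}_1,\boldsymbol{x}_2,\ldots\in\mathbb{R}^p$, and independent (not necessarily identically distributed) real random variables $\varepsilon_1,\varepsilon_2,\ldots$ with $\mathbb{E}(\varepsilon_i)=0$, $\mathrm{Var}(\varepsilon_i)=\sigma^2<\infty$ (the same for all $i$), and distribution functions $F_i$. For each $n$ let $\mathbf{X}_n=(\boldsymbol{x}_1,\ldots,\boldsymbol{x}_n)^T\in\mathbb{R}^{n\times p}$ and $\boldsymbol{Y}=\mathbf{X}_n\boldsymbol{\beta}+(\varepsilon_1,\ldots,\varepsilon_n)^T$. When $\mathrm{rank}(\mathbf{X}_n)=p$ the ordinary least squares estimator is $\boldsymbol{b}_n=(\mathbf{X}_n^T\mathbf{X}_n)^{-1}\mathbf{X}_n^T\boldsymbol{Y}$. Put $\mathbf{M}_n=(m_{ij;n})=\mathbf{X}_n^T\mathbf{X}_n$ and $\mathbf{D}_n=\mathrm{diag}(\sqrt{m_{11;n}},\ldots,\sqrt{m_{pp;n}})$; let $x_{i;n}$ denote the $i$-th component of $\boldsymbol{x}_n$. Assumptions: (i) $m_{ii;n}\to\infty$ as $n\to\infty$, $i=1,\ldots,p$; (ii) $x_{i;n+1}^2/m_{ii;n}\to0$ as $n\to\infty$, $i=1,\ldots,p$; (iii) $\mathbf{D}_n^{-1}\mathbf{M}_n\mathbf{D}_n^{-1}\to\mathbf{V}^{-1}$ as $n\to\infty$, with $\mathbf{V}^{-1}$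 nonsingular; (iii$'$) $n^{-1}\mathbf{X}_n^T\mathbf{X}_n\to\mathbf{V}^{-1}$ as $n\to\infty$, with $\mathbf{V}^{-1}\in\mathbb{R}^{p\times p}$ nonsingular; (iv) $\sup_{i\ge1}\int_{|u|>c}u^2\,dF_i(u)\to0$ as $c\to\infty$. For $R>0$, $\mathcal{LM}(R)$ is the family of such models (over all $p$, $\boldsymbol{\beta}$, design vectors and error distributions) for which either (i)–(iv) hold or (iii$'$) and (iv) hold, and $\sup_{i\ge1}\mathbb{E}|\varepsilon_i|^R<\infty$. Admissible normalization: $\mathbf{\Gamma}_n=\mathbf{D}_n$ if (i)–(iv) hold, with $\mathbf{V}$ from (iii); or $\mathbf{\Gamma}_n=\sqrt{n}\,\mathbf{I}_p$ if (iii$'$), (iv) hold, with $\mathbf{V}$ from (iii$'$). In either case $\mathbf{X}_n$ has rank $p$ for all sufficiently large $n$, and sequences indexed by $n$ are considered for those $n$ with $\mathrm{rank}(\mathbf{X}_n)=p$. It is known that $\mathbf{\Gamma}_n(\boldsymbol{b}_n-\boldsymbol{\beta})$ converges in distribution to $N_p(\boldsymbol{0},\sigma^2\mathbf{V})$. *)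

theory Defs
  imports
    "HOL-Probability.Probability"
    "HOL-Library.Landau_Symbols"
    "Jordan_Normal_Form.Gauss_Jordan_Elimination"
    "Jordan_Normal_Form.DL_Rank"
begin

unbundle no vec_syntax
unbundle no inner_syntax

text \<open>
  Vectors and matrices are those with explicit dimensions, because the number \<open>p\<close> of regressors
  is quantified inside the family of models.  Observations and coordinates are numbered from 0:
  \<open>design m i\<close> and \<open>err m i\<close> belong to the \<open>(i+1)\<close>-th observation.  The sample size \<open>n\<close> itself is
  not shifted, so the model with \<open>n\<close> observations uses the indices \<open>i < n\<close>.
\<close>

record 'w lin_model =
  nreg :: nat                             \<comment> \<open>\<open>p\<close>\<close>
  coeff :: "real vec"                     \<comment> \<open>\<open>\<beta>\<close>\<close>
  design :: "nat \<Rightarrow> real vec"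
  space_of :: "'w measure"                \<comment> \<open>the probability space carrying the errors\<close>
  err :: "nat \<Rightarrow> 'w \<Rightarrow> real"
  err_var :: real                         \<comment> \<open>\<open>\<sigma>\<^sup>2\<close>\<close>

definition linear_regression_model :: "'w lin_model \<Rightarrow> bool" where
  "linear_regression_model m \<longleftrightarrow>
     1 \<le> nreg m \<and>
     coeff m \<in> carrier_vec (nreg m) \<and>
     (\<forall>i. design m i \<in> carrier_vec (nreg m)) \<and>
     prob_space (space_of m) \<and>
     prob_space.indep_vars (space_of m) (\<lambda>_. borel) (err m) UNIV \<and>
     (\<forall>i. integrable (space_of m) (err m i) \<and>
          integrable (space_of m) (\<lambda>w. (err m i w)\<^sup>2) \<and>
          prob_space.expectation (space_of m) (err m i) = 0 \<and>
          prob_space.variance (space_of m) (err m i) = err_var m)"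

definition Xmat :: "'w lin_model \<Rightarrow> nat \<Rightarrow> real mat" where
  "Xmat m n = mat_of_rows (nreg m) (map (design m) [0..<n])"

definition Yvec :: "'w lin_model \<Rightarrow> nat \<Rightarrow> 'w \<Rightarrow> real vec" where
  "Yvec m n w = Xmat m n *\<^sub>v coeff m + Matrix.vec n (\<lambda>i. err m i w)"

definition Mmat :: "'w lin_model \<Rightarrow> nat \<Rightarrow> real mat" where
  "Mmat m n = (Xmat m n)\<^sup>T * Xmat m n"

definition Dmat :: "'w lin_model \<Rightarrow> nat \<Rightarrow> real mat" where
  "Dmat m n = mat_diag (nreg m) (\<lambda>i. sqrt (Mmat m n $$ (i, i)))"

text \<open>The value is meaningful for invertible matrices only.\<close>

definition mat_inv :: "real mat \<Rightarrow> real mat" where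
  "mat_inv A = the (mat_inverse A)"

definition ols :: "'w lin_model \<Rightarrow> nat \<Rightarrow> 'w \<Rightarrow> real vec" where
  "ols m n w = mat_inv ((Xmat m n)\<^sup>T * Xmat m n) *\<^sub>v ((Xmat m n)\<^sup>T *\<^sub>v Yvec m n w)"

definition mat_tendsto :: "(nat \<Rightarrow> real mat) \<Rightarrow> real mat \<Rightarrow> bool" where
  "mat_tendsto A L \<longleftrightarrow>
     (\<forall>i<dim_row L. \<forall>j<dim_col L. (\<lambda>n. A n $$ (i, j)) \<longlonglongrightarrow> L $$ (i, j))"

definition assm_i :: "'w lin_model \<Rightarrow> bool" where
  "assm_i m \<longleftrightarrow> (\<forall>i<nreg m. filterlim (\<lambda>n. Mmat m n $$ (i, i)) at_top sequentially)"

text \<open>Owing to the numbering from 0, \<open>design m n\<close> is the design vector of observation \<open>n + 1\<close>.\<close>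

definition assm_ii :: "'w lin_model \<Rightarrow> bool" where
  "assm_ii m \<longleftrightarrow> (\<forall>i<nreg m. (\<lambda>n. (design m n $ i)\<^sup>2 / Mmat m n $$ (i, i)) \<longlonglongrightarrow> 0)"

text \<open>
  The limit matrix is nonsingular and denoted \<open>V\<inverse>\<close>; the argument \<open>V\<close> is its inverse.  In
  \<open>assm_iii\<close>, \<open>Dmat m n\<close> may be singular for finitely many \<open>n\<close>, which does not affect the limit.
\<close>

definition assm_iii :: "'w lin_model \<Rightarrow> real mat \<Rightarrow> bool" where
  "assm_iii m V \<longleftrightarrow>
     V \<in> carrier_mat (nreg m) (nreg m) \<and> invertible_mat V \<and>
     mat_tendsto (\<lambda>n. mat_inv (Dmat m n) * Mmat m n * mat_inv (Dmat m n)) (mat_inv V)"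

definition assm_iii' :: "'w lin_model \<Rightarrow> real mat \<Rightarrow> bool" where
  "assm_iii' m V \<longleftrightarrow>
     V \<in> carrier_mat (nreg m) (nreg m) \<and> invertible_mat V \<and>
     mat_tendsto (\<lambda>n. (1 / real n) \<cdot>\<^sub>m ((Xmat m n)\<^sup>T * Xmat m n)) (mat_inv V)"

definition err_law :: "'w lin_model \<Rightarrow> nat \<Rightarrow> real measure" where
  "err_law m i = distr (space_of m) borel (err m i)"

definition assm_iv :: "'w lin_model \<Rightarrow> bool" where
  "assm_iv m \<longleftrightarrow>
     ((\<lambda>c::real. SUP i. \<integral>\<^sup>+u\<in>{u. c < \<bar>u\<bar>}. ennreal (u\<^sup>2) \<partial>err_law m i) \<longlongrightarrow> 0) at_top"

definition assms_D :: "'w lin_model \<Rightarrow> real mat \<Rightarrow> bool" where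
  "assms_D m V \<longleftrightarrow> assm_i m \<and> assm_ii m \<and> assm_iii m V \<and> assm_iv m"

definition assms_sqrt :: "'w lin_model \<Rightarrow> real mat \<Rightarrow> bool" where
  "assms_sqrt m V \<longleftrightarrow> assm_iii' m V \<and> assm_iv m"

definition LM :: "real \<Rightarrow> 'w lin_model set" where
  "LM R = {m. linear_regression_model m \<and>
              ((\<exists>V. assms_D m V) \<or> (\<exists>V. assms_sqrt m V)) \<and>
              (SUP i. \<integral>\<^sup>+w. ennreal (\<bar>err m i w\<bar> powr R) \<partial>space_of m) < \<infinity>}"

definition admissible_norm :: "'w lin_model \<Rightarrow> (nat \<Rightarrow> real mat) \<Rightarrow> real mat \<Rightarrow> bool" where
  "admissible_norm m \<Gamma> V \<longleftrightarrow>
     (assms_D m V \<and> \<Gamma> = Dmat m) \<or>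
     (assms_sqrt m V \<and> \<Gamma> = (\<lambda>n. sqrt (real n) \<cdot>\<^sub>m 1\<^sub>m (nreg m)))"

definition xi ::
  "'w lin_model \<Rightarrow> (nat \<Rightarrow> real mat) \<Rightarrow> real vec \<Rightarrow> nat \<Rightarrow> 'w \<Rightarrow> real" where
  "xi m \<Gamma> \<alpha> n w = \<alpha> \<bullet> (\<Gamma> n *\<^sub>v (ols m n w - coeff m))"

text \<open>The normal distribution with mean \<open>\<mu>\<close> and variance \<open>v \<ge> 0\<close>, a point mass if \<open>v = 0\<close>.\<close>

definition normal_law :: "real \<Rightarrow> real \<Rightarrow> real measure" where
  "normal_law \<mu> v =
     (if v = 0 then return borel \<mu> else density lborel (normal_density \<mu> (sqrt v)))"

text \<open>Sequences built from \<open>ols m n\<close> are considered only for those \<open>n\<close> where it is defined.\<close>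

definition full_rank_sequentially :: "'w lin_model \<Rightarrow> nat filter" where
  "full_rank_sequentially m =
     inf sequentially (principal {n. vec_space.rank n (Xmat m n) = nreg m})"

definition determines_rate ::
  "'w lin_model \<Rightarrow> (nat \<Rightarrow> real mat) \<Rightarrow> real mat \<Rightarrow> (nat \<Rightarrow> real) \<Rightarrow> nat \<Rightarrow> bool" where
  "determines_rate m \<Gamma> V a r \<longleftrightarrow>
     (\<forall>\<alpha>\<in>carrier_vec (nreg m).
        (\<lambda>n. prob_space.expectation (space_of m) (\<lambda>w. xi m \<Gamma> \<alpha> n w ^ r)
             - (\<integral>u. u ^ r \<partial>normal_law 0 (err_var m * (\<alpha> \<bullet> (V *\<^sub>v \<alpha>)))))
        \<in> O[full_rank_sequentially m](\<lambda>n. 1 / a n))"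

text \<open>
  A model affects the moments only through the joint law of its error sequence, and every such
  law lives on the sequence space \<open>nat \<Rightarrow> real\<close>.  Fixing this as the sample type therefore
  loses no model, while the sigma-algebra, the probability measure and the error variables on
  it remain arbitrary.
\<close>

type_synonym seq_model = "(nat \<Rightarrow> real) lin_model"

end

theory Submission
  imports Defs
begin

text \<open>
  The second moment alone defeats every sequence \<open>a\<close>.  Take one regressor, errors \<open>\<plusminus>1\<close> with equal
  probability and \<open>\<Gamma>\<^sub>n = \<surd>n\<close>, and let \<open>s\<^sub>n\<close> be the sum of the squared design values, with
  \<open>s\<^sub>n / n \<rightarrow> 1\<close>.  For \<open>\<alpha> = 1\<close> the second moment of \<open>\<xi>\<^sub>n\<close> is \<open>n / s\<^sub>n\<close>, and that of the limit
  is 1, so the rate is dictated by the design.  Squared design values \<open>1 + d i\<close>, with \<open>d\<close> decreasing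
  to 0 and \<open>d n \<ge> 1 / \<surd>(a n)\<close>, give \<open>s\<^sub>n \<ge> n (1 + d n)\<close>, hence an error of order at least
  \<open>1 / \<surd>(a n)\<close>, which is not \<open>O(1 / a n)\<close>.
\<close>

section \<open>Null sequences: averages and monotone majorants\<close>

text \<open>Used to show that the design sums divided by \<open>n\<close> tend to 1: a fixed head is
  swamped by \<open>n\<close>, and the remaining terms are small.\<close>

lemma cesaro_null:
  fixes f :: "nat \<Rightarrow> real"
  assumes "f \<longlonglongrightarrow> 0"
  shows "(\<lambda>n. (\<Sum>i<n. f i) / real n) \<longlonglongrightarrow> 0"
proof (rule LIMSEQ_I)
  fix e :: real assume "0 < e"
  then obtain N where N: "\<And>n. n \<ge> N \<Longrightarrow> \<bar>f n\<bar> < e / 2"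
    using LIMSEQ_D[OF assms, of "e / 2"] by auto
  define C where "C = (\<Sum>i<N. \<bar>f i\<bar>)"
  have C: "C \<ge> 0" by (simp add: C_def sum_nonneg)
  \<comment> \<open>\<open>K\<close> is chosen so that the head \<open>C\<close> takes less than
    half of the error budget \<open>e * n\<close>.\<close>
  obtain K where K: "real K > 2 * C / e" using reals_Archimedean2 by blast
  show "\<exists>no. \<forall>n\<ge>no. norm ((\<Sum>i<n. f i) / real n - 0) < e"
  proof (intro exI allI impI)
    fix n assume n: "n \<ge> max (Suc K) N"
    then have n0: "n > 0" "n \<ge> N" "real n > 2 * C / e" using K by auto
    have "\<bar>\<Sum>i<n. f i\<bar> \<le> (\<Sum>i<n. \<bar>f i\<bar>)" by (rule sum_abs)
    also have "\<dots> = C + (\<Sum>i=N..<n. \<bar>f i\<bar>)"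
      unfolding C_def using n0 by (simp add: lessThan_atLeast0 sum.atLeastLessThan_concat)
    also have "(\<Sum>i=N..<n. \<bar>f i\<bar>) \<le> (\<Sum>i=N..<n. e / 2)"
      using N by (intro sum_mono) (simp add: less_imp_le)
    also have "\<dots> \<le> real n * (e / 2)"
      using \<open>0 < e\<close> by simp
    also have "C < real n * (e / 2)"
      using n0(3) \<open>0 < e\<close> by (simp add: field_simps)
    finally have "\<bar>\<Sum>i<n. f i\<bar> < e * real n" by simp
    then show "norm ((\<Sum>i<n. f i) / real n - 0) < e"
      using n0 by (simp add: pos_divide_less_eq)
  qed
qed

text \<open>The tail supremum serves. The sequence \<open>a\<close> is not assumed monotone, while
  the lower bound on the design sums wants a decreasing \<open>d\<close>.\<close>

lemma antimono_null_majorant: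
  fixes e :: "nat \<Rightarrow> real"
  assumes "e \<longlonglongrightarrow> 0"
  obtains d :: "nat \<Rightarrow> real" where "antimono d" "d \<longlonglongrightarrow> 0" "\<And>n. e n \<le> d n"
proof
  define d where "d n = (SUP k\<in>{n..}. e k)" for n
  have bdd: "bdd_above (e ` A)" for A
    using convergent_imp_bounded[OF assms] bounded_subset[of "range e" "e ` A"]
    by (auto intro!: bounded_imp_bdd_above)
  show mono: "antimono d"
    unfolding d_def by (intro antimonoI cSUP_subset_mono bdd) auto
  show le: "e n \<le> d n" for n
    unfolding d_def by (intro cSUP_upper bdd) auto
  show "d \<longlonglongrightarrow> 0"
  proof (rule LIMSEQ_I)
    fix r :: real assume "0 < r"
    then obtain N where N: "\<And>n. n \<ge> N \<Longrightarrow> \<bar>e n\<bar> < r / 2"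
      using LIMSEQ_D[OF assms, of "r / 2"] by auto
    show "\<exists>no. \<forall>n\<ge>no. norm (d n - 0) < r"
    proof (intro exI allI impI)
      fix n assume n: "n \<ge> N"
      have "d n \<le> r / 2"
        unfolding d_def
      proof (rule cSUP_least)
        fix k assume "k \<in> {n..}"
        then show "e k \<le> r / 2" using N[of k] n by auto
      qed simp
      moreover have "- (r / 2) < d n" using N[OF n] le[of n] by (simp add: abs_less_iff)
      ultimately show "norm (d n - 0) < r" using \<open>0 < r\<close> by simp
    qed
  qed
qed

section \<open>Matrix inverses and the rank of a column\<close>

text \<open>\<open>mat_inv\<close> extracts from an option, so \<open>None\<close> is excluded
  first, as \<open>A\<close> is a unit; the left inverse \<open>C\<close> then equals
  \<open>C * (A * B) = B\<close>.\<close>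

lemma mat_inv_eqI:
  assumes "A \<in> carrier_mat n n" "B \<in> carrier_mat n n" "A * B = 1\<^sub>m n" "B * A = 1\<^sub>m n"
  shows "mat_inv A = B"
proof (cases "mat_inverse A")
  case None
  then have "A \<notin> Units (ring_mat TYPE(real) n ())"
    by (rule mat_inverse(1)[OF assms(1)])
  then show ?thesis using assms by (auto simp: Units_def ring_mat_def)
next
  case (Some C)
  then have C: "C * A = 1\<^sub>m n" "C \<in> carrier_mat n n"
    using mat_inverse(2)[OF assms(1)] by auto
  have "C = C * (A * B)" unfolding assms(3) using C(2) by simp
  also have "\<dots> = (C * A) * B" using C(2) assms(1,2) by (simp add: assoc_mult_mat)
  also have "\<dots> = B" unfolding C(1) using assms(2) by simp
  finally show ?thesis using Some by (simp add: mat_inv_def)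
qed

lemma mat_inv_scalar:
  fixes s :: real
  assumes "s \<noteq> 0"
  shows "mat_inv (Matrix.mat 1 1 (\<lambda>_. s)) = Matrix.mat 1 1 (\<lambda>_. 1 / s)"
  by (rule mat_inv_eqI[of _ 1]) (use assms in \<open>auto simp: scalar_prod_def\<close>)

text \<open>A lone nonzero vector is linearly independent, and independent columns give full
  rank.\<close>

lemma rank_single_column:
  fixes A :: "'a::field mat"
  assumes "A \<in> carrier_mat n 1" "col A 0 \<noteq> 0\<^sub>v n"
  shows "vec_space.rank n A = 1"
proof -
  interpret vec_space "TYPE('a)" n .
  have cols: "cols A = [col A 0]" using assms(1) by (auto simp: cols_def)
  have c: "col A 0 \<in> carrier_vec n" using assms(1) by auto
  have "lin_indpt {col A 0}"
  proof (rule finite_lin_indpt2)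
    fix a assume "lincomb a {col A 0} = 0\<^sub>v n"
    then have "a (col A 0) \<cdot>\<^sub>v col A 0 = 0\<^sub>v n"
      using c by (simp add: lincomb_def)
    then show "\<forall>v\<in>{col A 0}. a v = 0" using assms c
      by (auto simp: vec_eq_iff)
  qed (use c in auto)
  then show ?thesis
    using lin_indpt_full_rank[OF assms(1)] by (simp add: cols)
qed

section \<open>Independent fair signs on the sequence space\<close>

text \<open>
  The sign in \<open>coin\<close> makes the errors bounded by 1 everywhere, not just almost everywhere.
\<close>

definition coin_space :: "(nat \<Rightarrow> real) measure" where
  "coin_space = PiM UNIV (\<lambda>_. measure_pmf (pmf_of_set {-1, 1}))"

definition coin :: "nat \<Rightarrow> (nat \<Rightarrow> real) \<Rightarrow> real" where
  "coin i w = (if w i < 0 then -1 else 1)"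

lemma prob_space_coin_space: "prob_space coin_space"
  unfolding coin_space_def by (intro prob_space_PiM measure_pmf.prob_space_axioms)

interpretation coin: prob_space coin_space
  by (rule prob_space_coin_space)

lemma measurable_coin_coordinate:
  "(\<lambda>w. w i) \<in> coin_space \<rightarrow>\<^sub>M measure_pmf (pmf_of_set {-1, 1})"
  unfolding coin_space_def by (rule measurable_component_singleton) simp

lemma measurable_coin [measurable]: "coin i \<in> borel_measurable coin_space"
  unfolding coin_def[abs_def]
  by (rule measurable_compose[OF measurable_coin_coordinate]) simp

lemma coin_square [simp]: "coin i w * coin i w = 1" "(coin i w)\<^sup>2 = 1" "\<bar>coin i w\<bar> = 1"
  by (auto simp: coin_def)

lemma integrable_coin [simp]: "integrable coin_space (coin i)"
  by (rule coin.integrable_const_bound[of _ 1]) auto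

text \<open>Each coordinate has the fair coin as its marginal law, which reduces the integral to a
  two-point average.\<close>

lemma expectation_coin [simp]: "coin.expectation (coin i) = 0"
proof -
  interpret product_prob_space "\<lambda>_. measure_pmf (pmf_of_set {-1, 1::real})" "UNIV :: nat set"
    by standard
  have "coin.expectation (coin i) =
      (\<integral>x. (if x < 0 then -1 else 1) \<partial>distr coin_space (measure_pmf (pmf_of_set {-1, 1::real})) (\<lambda>w. w i))"
    unfolding coin_def[abs_def] by (subst integral_distr[OF measurable_coin_coordinate]) auto
  also have "distr coin_space (measure_pmf (pmf_of_set {-1, 1::real})) (\<lambda>w. w i) =
      measure_pmf (pmf_of_set {-1, 1})"
    unfolding coin_space_def by (rule PiM_component) simp
  also have "(\<integral>x. (if x < 0 then -1 else 1) \<partial>measure_pmf (pmf_of_set {-1, 1::real})) = (0::real)"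
    by (subst integral_pmf_of_set) auto
  finally show ?thesis .
qed

text \<open>Under a product measure the joint law of the coordinates is the product of their
  marginals; taking the sign of each coordinate preserves independence.\<close>

lemma indep_vars_coin: "coin.indep_vars (\<lambda>_. borel) coin UNIV"
proof -
  let ?M = "measure_pmf (pmf_of_set {-1, 1::real})"
  interpret product_prob_space "\<lambda>_. ?M" "UNIV :: nat set"
    by standard
  have "coin.indep_vars (\<lambda>_. ?M) (\<lambda>i w. w i) UNIV"
  proof (subst coin.indep_vars_iff_distr_eq_PiM)
    have "distr coin_space ?M (\<lambda>w. w i) = ?M" for i
      unfolding coin_space_def by (rule PiM_component) simp
    then show "distr coin_space (PiM UNIV (\<lambda>_. ?M)) (\<lambda>w. \<lambda>i\<in>UNIV. w i) =
        PiM UNIV (\<lambda>i. distr coin_space ?M (\<lambda>w. w i))"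
      by (simp add: coin_space_def restrict_UNIV)
  qed (simp_all only: measurable_coin_coordinate UNIV_not_empty not_False_eq_True)
  then have "coin.indep_vars (\<lambda>_. borel) (\<lambda>i w. (if w i < 0 then -1 else 1 :: real)) UNIV"
    by (rule coin.indep_vars_compose2) simp
  then show ?thesis by (simp add: coin_def[abs_def])
qed

text \<open>For distinct indices independence factors the expectation into two zero means; on the
  diagonal the product is constantly 1.\<close>

lemma expectation_coin_mult:
  "coin.expectation (\<lambda>w. coin i w * coin j w) = (if i = j then 1 else 0)"
proof (cases "i = j")
  case True
  then show ?thesis by (simp add: coin.prob_space)
next
  case False
  have "coin.indep_vars (\<lambda>_. borel) coin {i, j}"
    using coin.indep_vars_subset[OF indep_vars_coin] by simp
  from coin.indep_vars_lebesgue_integral[OF _ this] False show ?thesis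
    by simp
qed

text \<open>Only the diagonal of the expanded double sum survives.\<close>

lemma expectation_coin_sum_square:
  "coin.expectation (\<lambda>w. (\<Sum>i<n. x i * coin i w)\<^sup>2) = (\<Sum>i<n. (x i)\<^sup>2)"
proof -
  have int: "integrable coin_space (\<lambda>w. coin i w * coin j w)" for i j
    by (rule coin.integrable_const_bound[of _ 1]) (auto simp: abs_mult)
  have "coin.expectation (\<lambda>w. (\<Sum>i<n. x i * coin i w)\<^sup>2) =
      coin.expectation (\<lambda>w. \<Sum>i<n. \<Sum>j<n. x i * x j * (coin i w * coin j w))"
    by (simp add: power2_eq_square sum_product mult_ac)
  also have "\<dots> = (\<Sum>i<n. \<Sum>j<n. x i * x j * (if i = j then 1 else 0))"
    by (simp add: int expectation_coin_mult)
  also have "\<dots> = (\<Sum>i<n. (x i)\<^sup>2)"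
    by (simp add: if_distrib power2_eq_square cong: if_cong)
  finally show ?thesis .
qed

section \<open>The regression with one regressor\<close>

text \<open>With \<open>coeff\<close> zero the response is the error vector itself; \<open>x\<close>
  stays free so that the design can be adapted to \<open>a\<close>.\<close>

definition coin_regression :: "(nat \<Rightarrow> real) \<Rightarrow> seq_model" where
  "coin_regression x = \<lparr>nreg = 1, coeff = 0\<^sub>v 1, design = (\<lambda>i. Matrix.vec 1 (\<lambda>_. x i)),
     space_of = coin_space, err = coin, err_var = 1\<rparr>"

lemma coin_regression_sel [simp]:
  "nreg (coin_regression x) = 1" "coeff (coin_regression x) = 0\<^sub>v 1"
  "design (coin_regression x) i = Matrix.vec 1 (\<lambda>_. x i)"
  "space_of (coin_regression x) = coin_space" "err (coin_regression x) = coin"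
  "err_var (coin_regression x) = 1"
  by (simp_all add: coin_regression_def)

lemma Xmat_coin_regression:
  "Xmat (coin_regression x) n = Matrix.mat n 1 (\<lambda>(i, j). x i)"
  by (rule eq_matI) (auto simp: Xmat_def mat_of_rows_index)

lemma gram_coin_regression:
  "(Xmat (coin_regression x) n)\<^sup>T * Xmat (coin_regression x) n =
     Matrix.mat 1 1 (\<lambda>_. \<Sum>i<n. (x i)\<^sup>2)"
  by (rule eq_matI)
    (auto simp: Xmat_coin_regression scalar_prod_def power2_eq_square lessThan_atLeast0)

lemma linear_regression_coin_regression: "linear_regression_model (coin_regression x)"
  unfolding linear_regression_model_def
  by (auto simp: prob_space_coin_space indep_vars_coin coin.prob_space)

lemma ols_coin_regression:
  assumes "(\<Sum>i<n. (x i)\<^sup>2) \<noteq> 0"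
  shows "ols (coin_regression x) n w =
    Matrix.vec 1 (\<lambda>_. (\<Sum>i<n. x i * coin i w) / (\<Sum>i<n. (x i)\<^sup>2))"
proof -
  have "Yvec (coin_regression x) n w = Matrix.vec n (\<lambda>i. coin i w)"
    by (rule eq_vecI) (auto simp: Yvec_def Xmat_coin_regression scalar_prod_def)
  then have "(Xmat (coin_regression x) n)\<^sup>T *\<^sub>v Yvec (coin_regression x) n w =
      Matrix.vec 1 (\<lambda>_. \<Sum>i<n. x i * coin i w)"
    by (intro eq_vecI) (auto simp: Xmat_coin_regression scalar_prod_def lessThan_atLeast0)
  then show ?thesis
    unfolding ols_def gram_coin_regression mat_inv_scalar[OF assms]
    by (intro eq_vecI) (auto simp: scalar_prod_def)
qed

text \<open>With s the sum of squared design values, \<open>xi\<close> is sqrt(n) / s times the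
  signed sum; that sum has second moment s, so n * s / s^2 remains.\<close>

lemma second_moment_coin_regression:
  assumes "(\<Sum>i<n. (x i)\<^sup>2) \<noteq> 0"
  shows "coin.expectation (\<lambda>w. xi (coin_regression x) (\<lambda>n. sqrt (real n) \<cdot>\<^sub>m 1\<^sub>m 1)
           (Matrix.vec 1 (\<lambda>_. 1)) n w ^ 2) = real n / (\<Sum>i<n. (x i)\<^sup>2)"
proof -
  have "xi (coin_regression x) (\<lambda>n. sqrt (real n) \<cdot>\<^sub>m 1\<^sub>m 1) (Matrix.vec 1 (\<lambda>_. 1)) n w ^ 2 =
      real n / (\<Sum>i<n. (x i)\<^sup>2)\<^sup>2 * (\<Sum>i<n. x i * coin i w)\<^sup>2" for w
    by (simp add: xi_def ols_coin_regression[OF assms] scalar_prod_def power_mult_distrib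
        power_divide)
  then show ?thesis using assms
    by (simp add: expectation_coin_sum_square) (simp add: power2_eq_square)
qed

section \<open>Assumptions, membership in the family and rank\<close>

text \<open>The errors have absolute value 1, so every tail integral with cutoff at least 1
  vanishes.\<close>

lemma assm_iv_coin_regression: "assm_iv (coin_regression x)"
proof -
  have "(\<integral>\<^sup>+u\<in>{u. c < \<bar>u\<bar>}. ennreal (u\<^sup>2) \<partial>err_law (coin_regression x) i) = 0"
    if "c \<ge> 1" for c :: real and i
    unfolding err_law_def
    by (subst nn_integral_distr) (use that in \<open>auto\<close>)
  then have "\<forall>\<^sub>F c in at_top. (SUP i. \<integral>\<^sup>+u\<in>{u. c < \<bar>u\<bar>}. ennreal (u\<^sup>2)
      \<partial>err_law (coin_regression x) i) = 0"
    by (intro eventually_at_top_linorderI[of 1]) simp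
  then show ?thesis
    unfolding assm_iv_def by (rule tendsto_eventually)
qed

text \<open>The scaled Gram matrix is the scalar in the hypothesis, so its limit is the identity,
  which is its own inverse.\<close>

lemma assms_sqrt_coin_regression:
  assumes "(\<lambda>n. (\<Sum>i<n. (x i)\<^sup>2) / real n) \<longlonglongrightarrow> 1"
  shows "assms_sqrt (coin_regression x) (1\<^sub>m 1)"
proof -
  have inv: "mat_inv (1\<^sub>m 1) = 1\<^sub>m 1" by (rule mat_inv_eqI[of _ 1]) auto
  have "invertible_mat (1\<^sub>m 1 :: real mat)"
    by (auto simp: invertible_mat_def inverts_mat_def intro!: exI[of _ "1\<^sub>m 1"])
  then show ?thesis
    using assms unfolding assms_sqrt_def assm_iii'_def mat_tendsto_def inv
    by (auto simp: assm_iv_coin_regression gram_coin_regression)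
qed

text \<open>All absolute moments of the errors equal 1, whatever \<open>R\<close>.\<close>

lemma coin_regression_in_LM:
  assumes "assms_sqrt (coin_regression x) V"
  shows "coin_regression x \<in> LM R"
  using assms unfolding LM_def
  by (auto simp: linear_regression_coin_regression coin.emeasure_space_1)

text \<open>The first design value alone makes the column nonzero, so the rank restriction removes
  no positive sample size.\<close>

lemma full_rank_sequentially_coin_regression:
  assumes "\<And>i. x i \<noteq> 0"
  shows "full_rank_sequentially (coin_regression x) = sequentially"
proof -
  have "vec_space.rank n (Xmat (coin_regression x) n) = 1" if "n > 0" for n
  proof (rule rank_single_column)
    show "col (Xmat (coin_regression x) n) 0 \<noteq> 0\<^sub>v n"
    proof
      assume "col (Xmat (coin_regression x) n) 0 = 0\<^sub>v n"
      then have "col (Xmat (coin_regression x) n) 0 $ 0 = 0" using that by simp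
      then show False using that assms[of 0] by (simp add: Xmat_coin_regression)
    qed
  qed (simp add: Xmat_coin_regression)
  then have "\<forall>\<^sub>F n in sequentially. n \<in> {n. vec_space.rank n (Xmat (coin_regression x) n) = 1}"
    by (intro eventually_at_top_linorderI[of 1]) simp
  then show ?thesis
    unfolding full_rank_sequentially_def
    by (simp add: inf_absorb1 le_principal)
qed

section \<open>The limiting moment and the contradiction\<close>

lemma normal_law_second_moment:
  "(\<integral>u. u\<^sup>2 \<partial>normal_law 0 1) = 1"
  using integral_std_normal_moment_even[of 1]
  by (simp add: normal_law_def integral_density normal_density_nonneg fact_numeral)

theorem proposition1:
  fixes R :: real
  assumes "R > 2"
  shows "\<not> (\<exists>a :: nat \<Rightarrow> real.
            (\<forall>n\<ge>1. a n > 0) \<and>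
            filterlim a at_top sequentially \<and>
            a \<in> O(\<lambda>n. real n) \<and>
            (\<forall>m \<in> (LM R :: seq_model set). \<forall>\<Gamma> V. admissible_norm m \<Gamma> V \<longrightarrow>
               (\<forall>r::nat. even r \<and> 0 < r \<and> real r < R \<longrightarrow> determines_rate m \<Gamma> V a r)))"
proof (rule notI, elim exE conjE)
  fix a :: "nat \<Rightarrow> real"
  assume lim: "filterlim a at_top sequentially"
    and rate: "\<forall>m \<in> (LM R :: seq_model set). \<forall>\<Gamma> V. admissible_norm m \<Gamma> V \<longrightarrow>
      (\<forall>r::nat. even r \<and> 0 < r \<and> real r < R \<longrightarrow> determines_rate m \<Gamma> V a r)"
  have sqrt_lim: "filterlim (\<lambda>n. sqrt (a n)) at_top sequentially"
    using filterlim_compose[OF sqrt_at_top lim] .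
  have "(\<lambda>n. inverse (sqrt (a n))) \<longlonglongrightarrow> 0"
    using tendsto_inverse_0_at_top[OF sqrt_lim] .
  then obtain d where d: "antimono d" "d \<longlonglongrightarrow> 0" and ge: "\<And>n. inverse (sqrt (a n)) \<le> d n"
    by (rule antimono_null_majorant) blast
  have d0: "d n \<ge> 0" for n
    using decseq_ge[OF d] by simp
  define x where "x i = sqrt (1 + d i)" for i
  define s where "s n = (\<Sum>i<n. (x i)\<^sup>2)" for n
  have s: "s n = real n + (\<Sum>i<n. d i)" for n
    using d0 by (simp add: s_def x_def sum.distrib add_nonneg_nonneg)
  have s_ge: "s n \<ge> real n * (1 + d n)" for n
  proof -
    \<comment> \<open>This is where the monotonicity of \<open>d\<close> enters.\<close>
    have "(\<Sum>i<n. d n) \<le> (\<Sum>i<n. d i)"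
      using antimonoD[OF d(1)] by (intro sum_mono) auto
    then show ?thesis by (simp add: s algebra_simps)
  qed
  have "(\<lambda>n. 1 + (\<Sum>i<n. d i) / real n) \<longlonglongrightarrow> 1 + 0"
    by (intro tendsto_add tendsto_const cesaro_null d)
  \<comment> \<open>At \<open>n = 0\<close> the equation fails: division by zero gives 1 on the left
    and 0 on the right.\<close>
  moreover have "\<forall>\<^sub>F n in sequentially. 1 + (\<Sum>i<n. d i) / real n = s n / real n"
    by (intro eventually_at_top_linorderI[of 1]) (simp add: s field_simps)
  ultimately have "(\<lambda>n. s n / real n) \<longlonglongrightarrow> 1"
    using filterlim_cong by force
  then have adm: "assms_sqrt (coin_regression x) (1\<^sub>m 1)"
    unfolding s_def by (rule assms_sqrt_coin_regression)
  \<comment> \<open>The hypothesis \<open>R > 2\<close> is what admits the moment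
    \<open>r = 2\<close>.\<close>
  then have "determines_rate (coin_regression x) (\<lambda>n. sqrt (real n) \<cdot>\<^sub>m 1\<^sub>m 1) (1\<^sub>m 1) a 2"
    using assms by (intro rate[rule_format] coin_regression_in_LM) (auto simp: admissible_norm_def)
  moreover have "Matrix.vec 1 (\<lambda>_. 1 :: real) \<bullet> (1\<^sub>m 1 *\<^sub>v Matrix.vec 1 (\<lambda>_. 1)) = 1"
    by (simp add: scalar_prod_def)
  moreover have "x i \<noteq> 0" for i
    using d0[of i] by (simp add: x_def)
  ultimately have "(\<lambda>n. coin.expectation (\<lambda>w. xi (coin_regression x)
      (\<lambda>n. sqrt (real n) \<cdot>\<^sub>m 1\<^sub>m 1) (Matrix.vec 1 (\<lambda>_. 1)) n w ^ 2) - 1) \<in> O(\<lambda>n. 1 / a n)"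
    unfolding determines_rate_def
    by (auto simp: full_rank_sequentially_coin_regression normal_law_second_moment
        dest!: bspec[of _ _ "Matrix.vec 1 (\<lambda>_. 1)"])
  then obtain C where C: "C > 0" "\<forall>\<^sub>F n in sequentially.
      \<bar>coin.expectation (\<lambda>w. xi (coin_regression x)
      (\<lambda>n. sqrt (real n) \<cdot>\<^sub>m 1\<^sub>m 1) (Matrix.vec 1 (\<lambda>_. 1)) n w ^ 2) - 1\<bar> \<le> C * \<bar>1 / a n\<bar>"
    by (auto elim!: landau_o.bigE)
  \<comment> \<open>\<open>d n < 1\<close> makes d / (1 + d) at least d / 2; the threshold
    \<open>2 * C\<close> is the bound that the final estimate contradicts.\<close>
  have "\<forall>\<^sub>F n in sequentially. n > 0 \<and> d n < 1 \<and> sqrt (a n) > 2 * C"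
    using eventually_gt_at_top[of 0] order_tendstoD(2)[OF d(2), of 1]
      filterlim_at_top_dense[THEN iffD1, OF sqrt_lim, rule_format, of "2 * C"]
    by (auto intro: eventually_conj)
  with C(2) have "\<forall>\<^sub>F n in sequentially. False"
  proof eventually_elim
    case (elim n)
    then have n: "real n > 0" "d n < 1" "sqrt (a n) > 2 * C" by auto
    have q: "sqrt (a n) > 0" using n C(1) by linarith
    then have a: "a n = sqrt (a n) * sqrt (a n)" "a n > 0" by auto
    have "real n * (1 + d n) > 0"
      using n d0[of n] by (intro mult_pos_pos) auto
    then have s_pos: "s n > 0" using s_ge[of n] by linarith
    then have "\<bar>real n / s n - 1\<bar> \<le> C / a n"
      using elim(1) a(2) second_moment_coin_regression[of x n] by (simp add: s_def)
    moreover have "real n / s n \<le> 1 / (1 + d n)"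
    proof -
      have "real n / s n \<le> real n / (real n * (1 + d n))"
        using s_ge[of n] s_pos n d0[of n] by (intro divide_left_mono mult_pos_pos) auto
      then show ?thesis using n by simp
    qed
    ultimately have "1 - 1 / (1 + d n) \<le> C / a n" by linarith
    moreover have "d n / 2 \<le> 1 - 1 / (1 + d n)"
      using d0[of n] n mult_left_mono[of "d n" 1 "d n"] by (simp add: field_simps)
    ultimately have "inverse (sqrt (a n)) \<le> 2 * C / a n"
      using ge[of n] by linarith
    \<comment> \<open>Clearing denominators and writing \<open>a n\<close> as the square of its root
      leaves one factor of the root to cancel.\<close>
    then have "sqrt (a n) * sqrt (a n) \<le> 2 * C * sqrt (a n)"
      using q a(2) by (simp add: field_simps)
    then have "sqrt (a n) \<le> 2 * C"
      by (rule mult_right_le_imp_le[OF _ q])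
    then show False using n by simp
  qed
  then show False by simp
qed

end
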